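(* The method for evaluating the trustworthiness $t_{ij}^k$ of votes (with $\alpha\in[0,1]$, reported beliefs in $[0,1]$, and $W$ either the logarithmic or the quadratic scoring function) is incentive compatible. That is, the expected trustworthiness $\mathbb{E}[t_{ij}^k]$ of a voter $i$, as a function of her reported prior belief $y_{rj}^i(k)$ and reported posterior belief ${y_{rj}^i}'(k)$, is maximized by the truthful reports $y_{rj}^i(k)=p_1$ and ${y_{rj}^i}'(k)=p_2$, and only by behaving honestly can the voter maximize it.
   Context: There are $N$ voters. Fix a round $k$, a candidate $j$, a voter $i$ and a random peer voter $r\neq i$. $c_{ij}^k\in\{0,1\}$ indicates whether voter $i$ votes for candidate $j$ in round $k$ (similarly $c_{rj}^k$), and $\hat c_{rj}\in\{0,1\}$ indicates whether voter $r$ picks candidate $j$ in the long term. Each voter $n$ reports a prior belief $y_{rj}^n(k)\in[0,1]$ and, after her own choice is determined, a posterior belief ${y_{rj}^n}'(k)\in[0,1]$ about how likely voter $r$ will vote for candidate $j$. The trustworthiness of voter $i$'s choice is $$t_{ij}^k=\alpha W\big(y_{rj}^i(k),c_{rj}^k\big)+(1-\alpha)W\big({y_{rj}^i}'(k),c_{rj}^k\big)+\beta,$$ $$\beta=-\frac1N\sum_{n=1}^N\Big[\alpha W\big(y_{rj}^n(k),c_{rj}^k\big)+(1-\alpha)W\big({y_{rj}^n}'(k),c_{rj}^k\big)\Big],$$ where $\alpha\in[0,1]$ is a scaling parameter and $W$ is either logarithmic, $W(y,1)=\ln y$, $W(y,0)=\ln(1-y)$, or quadratic, $W(y,1)=2y-y^2$,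 $W(y,0)=1-y^2$. The true probabilities are $p_1=P(\hat c_{rj}=1)$ (prior) and $p_2=P(\hat c_{rj}=1\mid c_{ij}^k=c)$ when voter $i$'s own choice is $c_{ij}^k=c\in\{0,1\}$ (posterior). In the expectation, the term with voter $i$'s prior report is averaged with $c_{rj}^k=1$ having probability $p_1$, and the term with her posterior report with $c_{rj}^k=1$ having probability $p_2$: $$\mathbb{E}[t_{ij}^k]=\alpha\Big(1-\frac1N\Big)\big[p_1W(y,1)+(1-p_1)W(y,0)\big]+(1-\alpha)\Big(1-\frac1N\Big)\big[p_2W(y',1)+(1-p_2)W(y',0)\big]-\frac1N\sum_{n\ne i}\Big[\alpha W\big(y_{rj}^n(k),c_{rj}^k\big)+(1-\alpha)W\big({y_{rj}^n}'(k),c_{rj}^k\big)\Big],$$ with $y=y_{rj}^i(k)$, $y'={y_{rj}^i}'(k)$. Incentive compatible means that a voter obtains a higher score when telling the truth than when lying, telling the truth being $y=p_1$, $y'=p_2$.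
   Formalization: Uniqueness is claimed for the prior report only if α≠0 and for the posterior report only if α≠1 (a report with weight 0 has no effect), and only when no other voter's score is −∞ (log rule, probability 0 given to the realised vote), where the expectation is not a finite number. *)

theory Defs
  imports "HOL-Probability.Probability"
begin

text \<open>
  Scores are extended reals because the logarithmic rule is also used at the reports 0 and 1, where
  \<open>ln 0\<close> has to be minus infinity (the library has \<open>ln (0::real) = 0\<close>). In \<^typ>\<open>ereal\<close> we have
  \<open>0 * (-\<infinity>) = 0\<close>, so a score that is attained with probability 0 or enters with weight 0 does not
  contribute. The Boolean argument is the vote being scored (\<open>True\<close> for 1, \<open>False\<close> for 0).
\<close>

definition ln_ext :: "real \<Rightarrow> ereal" where
  "ln_ext x = (if x = 0 then -\<infinity> else ereal (ln x))"

definition log_score :: "real \<Rightarrow> bool \<Rightarrow> ereal" where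
  "log_score y c = (if c then ln_ext y else ln_ext (1 - y))"

definition quad_score :: "real \<Rightarrow> bool \<Rightarrow> ereal" where
  "quad_score y c = ereal (if c then 2 * y - y\<^sup>2 else 1 - y\<^sup>2)"

definition report_score ::
  "(real \<Rightarrow> bool \<Rightarrow> ereal) \<Rightarrow> real \<Rightarrow> real \<Rightarrow> real \<Rightarrow> bool \<Rightarrow> ereal" where
  "report_score W \<alpha> y y' c = ereal \<alpha> * W y c + ereal (1 - \<alpha>) * W y' c"

text \<open>
  Candidate, round and peer are fixed. Voters are \<open>1, \<dots>, N\<close>; \<open>Y n\<close> and \<open>Y' n\<close> are the prior and
  posterior reports of voter \<open>n\<close> about the peer, and \<open>c\<close> is the peer's vote in the round.
\<close>

definition score_offset ::
  "(real \<Rightarrow> bool \<Rightarrow> ereal) \<Rightarrow> real \<Rightarrow> nat \<Rightarrow> (nat \<Rightarrow> real) \<Rightarrow> (nat \<Rightarrow> real) \<Rightarrow> bool \<Rightarrow> ereal" where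
  "score_offset W \<alpha> N Y Y' c =
     - (ereal (1 / real N) * (\<Sum>n = 1..N. report_score W \<alpha> (Y n) (Y' n) c))"

definition trustworthiness ::
  "(real \<Rightarrow> bool \<Rightarrow> ereal) \<Rightarrow> real \<Rightarrow> nat \<Rightarrow> (nat \<Rightarrow> real) \<Rightarrow> (nat \<Rightarrow> real) \<Rightarrow> nat \<Rightarrow> bool \<Rightarrow> ereal" where
  "trustworthiness W \<alpha> N Y Y' i c =
     ereal \<alpha> * W (Y i) c + ereal (1 - \<alpha>) * W (Y' i) c + score_offset W \<alpha> N Y Y' c"

definition expected_score :: "(real \<Rightarrow> bool \<Rightarrow> ereal) \<Rightarrow> real \<Rightarrow> real \<Rightarrow> ereal" where
  "expected_score W p y = ereal p * W y True + ereal (1 - p) * W y False"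

text \<open>
  Voter \<open>i\<close>'s prior and posterior terms (including her own share of the offset) are averaged with
  \<open>p1\<close> and \<open>p2\<close> respectively; the other voters' scores are taken at the actual vote \<open>c\<close>.
\<close>

definition expected_trustworthiness ::
  "(real \<Rightarrow> bool \<Rightarrow> ereal) \<Rightarrow> real \<Rightarrow> nat \<Rightarrow> real \<Rightarrow> real \<Rightarrow>
   (nat \<Rightarrow> real) \<Rightarrow> (nat \<Rightarrow> real) \<Rightarrow> nat \<Rightarrow> bool \<Rightarrow> ereal" where
  "expected_trustworthiness W \<alpha> N p1 p2 Y Y' i c =
     ereal (\<alpha> * (1 - 1 / real N)) * expected_score W p1 (Y i)
     + ereal ((1 - \<alpha>) * (1 - 1 / real N)) * expected_score W p2 (Y' i)
     - ereal (1 / real N) * (\<Sum>n \<in> {1..N} - {i}. report_score W \<alpha> (Y n) (Y' n) c)"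

text \<open>
  The two notions agree when the vote is certain. Finiteness is needed because
  \<^const>\<open>trustworthiness\<close> contains voter \<open>i\<close>'s own scores with both signs.
\<close>

lemma expected_trustworthiness_certain:
  assumes i: "i \<in> {1..N}"
    and fin: "\<And>n b. n \<in> {1..N} \<Longrightarrow> \<bar>W (Y n) b\<bar> \<noteq> \<infinity>" "\<And>n b. n \<in> {1..N} \<Longrightarrow> \<bar>W (Y' n) b\<bar> \<noteq> \<infinity>"
  shows "expected_trustworthiness W \<alpha> N (of_bool c) (of_bool c) Y Y' i c
         = trustworthiness W \<alpha> N Y Y' i c"
proof -
  define u where "u n b = real_of_ereal (W (Y n) b)" for n b
  define v where "v n b = real_of_ereal (W (Y' n) b)" for n b
  have u: "W (Y n) b = ereal (u n b)" and v: "W (Y' n) b = ereal (v n b)"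
    if "n \<in> {1..N}" for n b
    using fin[OF that] by (simp_all add: u_def v_def ereal_real)
  let ?s = "\<lambda>n. \<alpha> * u n c + (1 - \<alpha>) * v n c"
  have s: "(\<Sum>n\<in>A. report_score W \<alpha> (Y n) (Y' n) c) = ereal (\<Sum>n\<in>A. ?s n)" if "A \<subseteq> {1..N}" for A
  proof -
    have "(\<Sum>n\<in>A. report_score W \<alpha> (Y n) (Y' n) c) = (\<Sum>n\<in>A. ereal (?s n))"
      using that by (intro sum.cong) (auto simp: report_score_def u v subset_iff)
    then show ?thesis by simp
  qed
  have split: "(\<Sum>n=1..N. ?s n) = ?s i + (\<Sum>n\<in>{1..N} - {i}. ?s n)"
    using i by (intro sum.remove) auto
  show ?thesis
    unfolding expected_trustworthiness_def trustworthiness_def score_offset_def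
      expected_score_def s[OF subset_refl] s[OF Diff_subset] u[OF i] v[OF i] split
    by (cases c) (simp_all add: algebra_simps add_divide_distrib diff_divide_distrib)
qed

end

(* Both scoring rules are strictly proper: the expected score S(p, y) of a report y against the true
   probability p is finite at y = p and strictly smaller at every other y in [0, 1]. For the quadratic
   rule S(p, p) - S(p, y) = (p - y)^2; for the logarithmic rule the difference is a Kullback-Leibler
   divergence. The expected trustworthiness is a sum of two such scores with nonnegative weights and a
   term that does not depend on the voter's own reports. If that term is infinite, which happens when
   another voter has score minus infinity, the expected trustworthiness is constantly infinity. *)
theory Submission
  imports Defs
begin

text \<open>Finiteness at the truthful report is included because in \<open>ereal\<close> a strict
  drop in one summand can be absorbed by an infinite other summand.\<close>

definition strictly_proper :: "(real \<Rightarrow> bool \<Rightarrow> ereal) \<Rightarrow> bool" where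
  "strictly_proper W \<longleftrightarrow>
     (\<forall>p\<in>{0..1}. \<bar>expected_score W p p\<bar> \<noteq> \<infinity> \<and>
       (\<forall>y\<in>{0..1}. y \<noteq> p \<longrightarrow> expected_score W p y < expected_score W p p))"

lemma strictly_properD:
  assumes "strictly_proper W" "p \<in> {0..1}" "y \<in> {0..1}"
  shows strictly_proper_finite: "\<bar>expected_score W p p\<bar> \<noteq> \<infinity>"
    and strictly_proper_le: "expected_score W p y \<le> expected_score W p p"
    and strictly_proper_less: "y \<noteq> p \<Longrightarrow> expected_score W p y < expected_score W p p"
proof -
  have "\<bar>expected_score W p p\<bar> \<noteq> \<infinity> \<and>
      (\<forall>y\<in>{0..1}. y \<noteq> p \<longrightarrow> expected_score W p y < expected_score W p p)"
    using assms(1,2) unfolding strictly_proper_def by (rule bspec)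
  then show "\<bar>expected_score W p p\<bar> \<noteq> \<infinity>"
    and less: "y \<noteq> p \<Longrightarrow> expected_score W p y < expected_score W p p"
    using assms(3) by simp_all
  show "expected_score W p y \<le> expected_score W p p"
    using less by (cases "y = p") auto
qed

lemma strictly_proper_quad_score: "strictly_proper quad_score"
proof -
  have *: "expected_score quad_score p y = ereal (p\<^sup>2 - (p - y)\<^sup>2 + 1 - p)" for p y
    \<comment> \<open>The first pass moves the arithmetic from \<open>ereal\<close> to the reals,
      the second compares polynomials.\<close>
    by (simp add: expected_score_def quad_score_def) (simp add: algebra_simps power2_eq_square)
  show ?thesis
    unfolding strictly_proper_def * by auto
qed

text \<open>Gibbs' inequality for two outcomes: \<open>ln t \<le> t - 1\<close>, with equality only
  at \<open>t = 1\<close>, is applied to the ratios \<open>y / p\<close> and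
  \<open>(1 - y) / (1 - p)\<close>. The weighted bounds \<open>y - p\<close> and
  \<open>p - y\<close> cancel, and strictness comes from the first ratio.\<close>

lemma cross_entropy_less:
  fixes p y :: real
  assumes "0 < p" "p < 1" "0 < y" "y < 1" "y \<noteq> p"
  shows "p * ln y + (1 - p) * ln (1 - y) < p * ln p + (1 - p) * ln (1 - p)"
proof -
  have "ln (y / p) < y / p - 1"
    using ln_le_minus_one[of "y / p"] ln_eq_minus_one[of "y / p"] assms by force
  then have "p * ln (y / p) < p * (y / p - 1)"
    using assms by (intro mult_strict_left_mono) auto
  moreover have "p * (y / p - 1) = y - p"
    using assms by (simp add: right_diff_distrib)
  moreover have "(1 - p) * ln ((1 - y) / (1 - p)) \<le> (1 - p) * ((1 - y) / (1 - p) - 1)"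
    using assms by (intro mult_left_mono ln_le_minus_one) auto
  moreover have "(1 - p) * ((1 - y) / (1 - p) - 1) = p - y"
    using assms by (subst right_diff_distrib) simp
  ultimately have "p * ln (y / p) + (1 - p) * ln ((1 - y) / (1 - p)) < 0"
    by linarith
  then show ?thesis
    using assms by (simp add: ln_div algebra_simps)
qed

lemma strictly_proper_log_score: "strictly_proper log_score"
proof -
  \<comment> \<open>At \<open>p = 0\<close> or \<open>p = 1\<close> the infinite logarithm has
    weight 0 and contributes 0.\<close>
  have finite: "\<bar>expected_score log_score p p\<bar> \<noteq> \<infinity>" if "p \<in> {0..1}" for p
    by (auto simp: expected_score_def log_score_def ln_ext_def)
  have "expected_score log_score p y < expected_score log_score p p"
    if p: "p \<in> {0..1}" and y: "y \<in> {0..1}" and "y \<noteq> p" for p y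
  proof -
    \<comment> \<open>For \<open>p\<close> equal to 0 or 1 only \<open>ln_ext (1 - y)\<close> or
      \<open>ln_ext y\<close> remains, which is negative for a lie, while the truth scores 0. For
      interior \<open>p\<close> a boundary report scores minus infinity with positive
      probability.\<close>
    consider "p = 0" | "p = 1" | "0 < p" "p < 1" "y = 0 \<or> y = 1" | "0 < p" "p < 1" "0 < y" "y < 1"
      using p y by fastforce
    then show ?thesis
    proof cases
      case 1
      then show ?thesis
        using that by (auto simp: expected_score_def log_score_def ln_ext_def simp flip: zero_ereal_def one_ereal_def)
    next
      case 2
      then show ?thesis
        using that by (auto simp: expected_score_def log_score_def ln_ext_def simp flip: zero_ereal_def one_ereal_def)
    next
      case 3
      then have "expected_score log_score p y = -\<infinity>"
        by (auto simp: expected_score_def log_score_def ln_ext_def)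
      then show ?thesis
        using finite[OF p] by auto
    next
      case 4
      then show ?thesis
        using cross_entropy_less[of p y] \<open>y \<noteq> p\<close>
        by (simp add: expected_score_def log_score_def ln_ext_def)
    qed
  qed
  with finite show ?thesis
    by (auto simp: strictly_proper_def)
qed

lemma (in prob_space) cond_prob_in_unit_interval:
  assumes "{x \<in> space M. Q x} \<in> events"
  shows "\<P>(x in M. P x \<bar> Q x) \<in> {0..1}"
proof -
  have "prob {x \<in> space M. P x \<and> Q x} \<le> prob {x \<in> space M. Q x}"
    using assms by (intro finite_measure_mono) auto
  \<comment> \<open>If \<open>Q\<close> has probability 0, the quotient is 0 by the convention for
    division.\<close>
  then show ?thesis
    by (auto simp: cond_prob_def divide_le_eq_1 zero_less_measure_iff)
qed

lemma ereal_mult_eq_pinfty_imp: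
  assumes "ereal a * x = \<infinity>" "0 \<le> a"
  shows "x = \<infinity>"
  using assms by (cases x) (auto split: if_splits)

text \<open>Neither rule attains plus infinity, and nonnegative weights cannot turn minus infinity
  into it. Hence excluding minus infinity makes a report score finite.\<close>

lemma report_score_neq_pinfty:
  assumes "W = log_score \<or> W = quad_score" "\<alpha> \<in> {0..1}"
  shows "report_score W \<alpha> y y' c \<noteq> \<infinity>"
proof -
  have "W z c \<noteq> \<infinity>" for z
    using assms(1) by (auto simp: log_score_def quad_score_def ln_ext_def split: if_splits)
  then have "ereal \<alpha> * W y c \<noteq> \<infinity>" "ereal (1 - \<alpha>) * W y' c \<noteq> \<infinity>"
    using assms(2) by (auto dest!: ereal_mult_eq_pinfty_imp)
  then show ?thesis
    by (simp add: report_score_def)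
qed

text \<open>The offset \<open>z\<close> may be infinite here, since subtraction is monotone on all of \<^typ>\<open>ereal\<close>.\<close>

lemma weighted_expected_score_le:
  assumes "strictly_proper W" "p \<in> {0..1}" "q \<in> {0..1}" "y \<in> {0..1}" "y' \<in> {0..1}" "0 \<le> a" "0 \<le> b"
  shows "ereal a * expected_score W p y + ereal b * expected_score W q y' - z
    \<le> ereal a * expected_score W p p + ereal b * expected_score W q q - z"
  using assms by (intro ereal_minus_mono add_mono ereal_mult_left_mono strictly_proper_le) auto

text \<open>Only the larger sides are assumed finite, since a lie may score minus infinity.\<close>

lemma ereal_add_less:
  fixes x y x' y' :: ereal
  assumes "x \<le> x'" "y \<le> y'" "\<bar>x'\<bar> \<noteq> \<infinity>" "\<bar>y'\<bar> \<noteq> \<infinity>" "x < x' \<or> y < y'"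
  shows "x + y < x' + y'"
  using assms by (cases x; cases x'; cases y; cases y') auto

lemma ereal_minus_strict_left_mono:
  fixes x y z :: ereal
  assumes "x < y" "\<bar>z\<bar> \<noteq> \<infinity>"
  shows "x - z < y - z"
  using assms by (cases x; cases y; cases z) auto

text \<open>A lie about a report of nonzero weight makes its term drop strictly while the other term
  does not rise. Finite truthful scores and a finite \<open>z\<close> preserve the drop.\<close>

lemma weighted_expected_score_less:
  assumes W: "strictly_proper W" and pq: "p \<in> {0..1}" "q \<in> {0..1}" and y: "y \<in> {0..1}" "y' \<in> {0..1}"
    and ab: "0 \<le> a" "0 \<le> b" and z: "\<bar>z\<bar> \<noteq> \<infinity>"
    and lie: "a \<noteq> 0 \<and> y \<noteq> p \<or> b \<noteq> 0 \<and> y' \<noteq> q"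
  shows "ereal a * expected_score W p y + ereal b * expected_score W q y' - z
    < ereal a * expected_score W p p + ereal b * expected_score W q q - z"
proof -
  have le: "ereal a * expected_score W p y \<le> ereal a * expected_score W p p"
    "ereal b * expected_score W q y' \<le> ereal b * expected_score W q q"
    using assms by (auto intro!: ereal_mult_left_mono strictly_proper_le)
  have less: "ereal d * expected_score W s x < ereal d * expected_score W s s"
    if "0 \<le> d" "d \<noteq> 0" "x \<noteq> s" "s \<in> {0..1}" "x \<in> {0..1}" for d s x
    using strictly_proper_less[OF W, of s x] that
    by (intro ereal_mult_strict_left_mono) auto
  have fin: "\<bar>ereal a * expected_score W p p\<bar> \<noteq> \<infinity>" "\<bar>ereal b * expected_score W q q\<bar> \<noteq> \<infinity>"
    using strictly_proper_finite[OF W pq(1) pq(1)] strictly_proper_finite[OF W pq(2) pq(2)] by auto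
  have "ereal a * expected_score W p y < ereal a * expected_score W p p \<or>
    ereal b * expected_score W q y' < ereal b * expected_score W q q"
    using lie less pq y ab by blast
  with le fin z show ?thesis
    by (intro ereal_minus_strict_left_mono ereal_add_less)
qed

theorem mainTheorem3:
  fixes M :: "'w measure"
    and N i r :: nat
    and choice longterm :: "nat \<Rightarrow> 'w \<Rightarrow> bool"
    and own :: bool
    and \<omega> :: 'w
    and \<alpha> p1 p2 :: real
    and W :: "real \<Rightarrow> bool \<Rightarrow> ereal"
    and Y Y' :: "nat \<Rightarrow> real"
    and E :: "real \<times> real \<Rightarrow> ereal"
    and reports :: "real \<times> real \<Rightarrow> bool"
  assumes "prob_space M"
    and "i \<in> {1..N}" and "r \<in> {1..N}" and "r \<noteq> i"
    and "\<And>n. n \<in> {1..N} \<Longrightarrow> choice n \<in> measurable M (count_space UNIV)"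
    and "\<And>n. n \<in> {1..N} \<Longrightarrow> longterm n \<in> measurable M (count_space UNIV)"
    and "\<P>(x in M. choice i x = own) > 0"
    and "p1 = \<P>(x in M. longterm r x)"
    and "p2 = \<P>(x in M. longterm r x \<bar> choice i x = own)"
    and "\<omega> \<in> space M"
    and "\<alpha> \<in> {0..1}"
    and "W = log_score \<or> W = quad_score"
    and "\<And>n. n \<in> {1..N} \<Longrightarrow> Y n \<in> {0..1}" and "\<And>n. n \<in> {1..N} \<Longrightarrow> Y' n \<in> {0..1}"
    and "E = (\<lambda>(y, y'). expected_trustworthiness W \<alpha> N p1 p2 (Y(i := y)) (Y'(i := y')) i (choice r \<omega>))"
    and "reports = (\<lambda>(y, y'). y \<in> {0..1} \<and> y' \<in> {0..1})"
  shows "is_arg_max E reports (p1, p2) \<and>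
    ((\<forall>n \<in> {1..N} - {i}. report_score W \<alpha> (Y n) (Y' n) (choice r \<omega>) \<noteq> -\<infinity>) \<longrightarrow>
      (\<forall>y y'. is_arg_max E reports (y, y') \<longrightarrow>
        (\<alpha> \<noteq> 0 \<longrightarrow> y = p1) \<and> (\<alpha> \<noteq> 1 \<longrightarrow> y' = p2)))"
proof -
  interpret prob_space M by fact
  have W: "strictly_proper W"
    using assms(12) strictly_proper_log_score strictly_proper_quad_score by blast
  have p1: "p1 \<in> {0..1}"
    by (simp add: assms(8))
  have "choice i -` {own} \<inter> space M \<in> events"
    using assms(2,5) by (intro measurable_sets) auto
  also have "choice i -` {own} \<inter> space M = {x \<in> space M. choice i x = own}"
    by auto
  finally have p2: "p2 \<in> {0..1}"
    unfolding assms(9) by (rule cond_prob_in_unit_interval)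
  \<comment> \<open>The voters \<open>i\<close> and \<open>r\<close> are distinct. With a single
    voter the factor \<open>1 - 1 / N\<close> would vanish.\<close>
  have "1 < N"
    using assms(2-4) by auto
  then have N: "0 < 1 - 1 / real N"
    by simp
  define a b where "a = \<alpha> * (1 - 1 / real N)" and "b = (1 - \<alpha>) * (1 - 1 / real N)"
  define others where "others = (\<Sum>n \<in> {1..N} - {i}. report_score W \<alpha> (Y n) (Y' n) (choice r \<omega>))"
  have ab: "0 \<le> a" "0 \<le> b"
    using N assms(11) by (auto simp: a_def b_def)
  \<comment> \<open>The updates at \<open>i\<close> do not reach the sum over the other voters, so
    \<open>others\<close> is constant in \<open>y\<close> and \<open>y'\<close>.\<close>
  have E: "E (y, y') = ereal a * expected_score W p1 y + ereal b * expected_score W p2 y'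
      - ereal (1 / real N) * others" for y y'
    by (simp add: assms(15) expected_trustworthiness_def a_def b_def others_def)
  have le: "E (y, y') \<le> E (p1, p2)" if "reports (y, y')" for y y'
    unfolding E using that W p1 p2 ab assms(16)
    by (intro weighted_expected_score_le) auto
  have truthful: "reports (p1, p2)"
    using p1 p2 assms(16) by simp
  have "(\<alpha> \<noteq> 0 \<longrightarrow> y = p1) \<and> (\<alpha> \<noteq> 1 \<longrightarrow> y' = p2)"
    if fin: "\<forall>n \<in> {1..N} - {i}. report_score W \<alpha> (Y n) (Y' n) (choice r \<omega>) \<noteq> -\<infinity>"
      and max: "is_arg_max E reports (y, y')" for y y'
  proof (rule ccontr)
    assume "\<not> ?thesis"
    then have lie: "a \<noteq> 0 \<and> y \<noteq> p1 \<or> b \<noteq> 0 \<and> y' \<noteq> p2"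
      using N by (auto simp: a_def b_def)
    \<comment> \<open>A finite sum in \<open>ereal\<close> is infinite only if some summand
      is.\<close>
    have "\<bar>others\<bar> \<noteq> \<infinity>"
      unfolding others_def sum_Inf using fin report_score_neq_pinfty[OF assms(12,11)] by auto
    then have "\<bar>ereal (1 / real N) * others\<bar> \<noteq> \<infinity>"
      by auto
    then have "E (y, y') < E (p1, p2)"
      unfolding E using max W p1 p2 ab lie assms(16)
      by (intro weighted_expected_score_less) (auto simp: is_arg_max_def)
    with max truthful show False
      by (auto simp: is_arg_max_def)
  qed
  moreover have "is_arg_max E reports (p1, p2)"
    using le truthful by (auto simp: is_arg_max_def not_less)
  ultimately show ?thesis
    by blast
qed

end
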